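(* Let $K$ be a finite polyhedral complex in $\mathbb{R}^n$, in which some cells may be unbounded. Then $K$ is homotopy equivalent to a bounded polyhedral complex having no more cells than $K$ has.
   Context: A polyhedral complex in $\mathbb{R}^n$ is a finite collection of closed convex polyhedra (cells), closed under taking faces, such that any two cells intersect in a common face (possibly empty); it is identified with the union of its cells. *)

theory Defs
  imports "HOL-Analysis.Analysis"
begin

text \<open>A polyhedral complex: a finite collection of closed convex polyhedra (cells),
closed under taking faces, any two cells meeting in a common face (possibly empty).
Faces are in the sense of the library's face_of (which includes the empty set and
the cell itself).\<close>
definition polyhedral_complex :: "'a::euclidean_space set set \<Rightarrow> bool" where
  "polyhedral_complex K \<longleftrightarrow>
     finite K \<and>
     (\<forall>c\<in>K. polyhedron c) \<and>
     (\<forall>c\<in>K. \<forall>f. f face_of c \<longrightarrow> f \<in> K) \<and>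
     (\<forall>c1\<in>K. \<forall>c2\<in>K. (c1 \<inter> c2) face_of c1 \<and> (c1 \<inter> c2) face_of c2)"

end

theory Submission
  imports Defs
begin

text \<open>Call a cell symmetric if its recession cone is a linear subspace. A cell that is not symmetric
  retracts onto its relative frontier. Only non-symmetric cells can have a non-symmetric face, so an
  inclusion-maximal non-symmetric cell is a proper face of no cell, and deleting it leaves a
  homotopy equivalent subcomplex. Once all cells are symmetric, cells that meet have the same
  recession cone, so cutting every cell with the orthogonal complement of its recession cone gives
  a complex of bounded cells, onto which the orthogonal projections retract the original one.\<close>

section \<open>Recession cones of closed convex sets and of their faces\<close>

text \<open>The empty set gets the whole space as its recession cone, so results that compare
  recession cones treat empty faces separately.\<close>

definition recession_cone :: "'a::real_vector set \<Rightarrow> 'a set" where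
  "recession_cone S = {v. \<forall>x\<in>S. \<forall>t\<ge>0. x + t *\<^sub>R v \<in> S}"

definition symmetric_recession :: "'a::real_vector set \<Rightarrow> bool" where
  "symmetric_recession S \<longleftrightarrow> (\<forall>v\<in>recession_cone S. - v \<in> recession_cone S)"

lemma recession_coneD:
  "v \<in> recession_cone S \<Longrightarrow> x \<in> S \<Longrightarrow> 0 \<le> t \<Longrightarrow> x + t *\<^sub>R v \<in> S"
  by (simp add: recession_cone_def)

lemma symmetric_recessionD:
  assumes "symmetric_recession S" "v \<in> recession_cone S" "x \<in> S"
  shows "x + t *\<^sub>R v \<in> S"
proof (cases "t \<ge> 0")
  case False
  then have "x + (- t) *\<^sub>R (- v) \<in> S"
    using assms by (intro recession_coneD) (auto simp: symmetric_recession_def)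
  then show ?thesis by simp
qed (use assms recession_coneD in blast)

lemma subspace_recession_cone:
  assumes "symmetric_recession S"
  shows "subspace (recession_cone S)"
proof (rule subspaceI)
  show "0 \<in> recession_cone S"
    by (simp add: recession_cone_def)
next
  fix v w assume "v \<in> recession_cone S" "w \<in> recession_cone S"
  then have "(x + t *\<^sub>R v) + t *\<^sub>R w \<in> S" if "x \<in> S" "t \<ge> 0" for x t
    using that by (intro recession_coneD)
  then show "v + w \<in> recession_cone S"
    by (simp add: recession_cone_def scaleR_add_right add.assoc)
next
  fix c v assume "v \<in> recession_cone S"
  then have "x + (t * c) *\<^sub>R v \<in> S" if "x \<in> S" for x t
    using that by (rule symmetric_recessionD[OF assms])
  then show "c *\<^sub>R v \<in> recession_cone S"
    by (simp add: recession_cone_def)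
qed

text \<open>One ray is enough: the segments from any other point \<open>y\<close> of
  \<open>S\<close> to points far out on the ray from \<open>x\<close> approach the parallel ray from
  \<open>y\<close>, which lies in \<open>S\<close> because \<open>S\<close> is closed.\<close>

lemma recession_cone_closed_convexI:
  fixes S :: "'a::real_normed_vector set"
  assumes "closed S" "convex S" "x \<in> S" and ray: "\<And>t. t \<ge> 0 \<Longrightarrow> x + t *\<^sub>R v \<in> S"
  shows "v \<in> recession_cone S"
  unfolding recession_cone_def
proof (intro CollectI ballI allI impI)
  fix y and t :: real
  assume "y \<in> S" "t \<ge> 0"
  define e where "e n = inverse (real (Suc n))" for n
  have e: "0 < e n" "e n \<le> 1" for n
    by (auto simp: e_def field_simps)
  \<comment> \<open>Going out to parameter \<open>t / e n\<close> offsets the weight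
    \<open>e n\<close>: the displacement is exactly \<open>t *\<^sub>R v\<close>, and only the base
    point varies, tending to \<open>y\<close>.\<close>
  have "(1 - e n) *\<^sub>R y + e n *\<^sub>R (x + (t / e n) *\<^sub>R v) \<in> S" for n
    using e[of n] \<open>y \<in> S\<close> \<open>t \<ge> 0\<close> by (intro convexD[OF \<open>convex S\<close>] ray) auto
  moreover have "(1 - e n) *\<^sub>R y + e n *\<^sub>R (x + (t / e n) *\<^sub>R v)
      = (1 - e n) *\<^sub>R y + e n *\<^sub>R x + t *\<^sub>R v" for n
    using e[of n] by (simp add: scaleR_add_right add.assoc)
  ultimately have mem: "(1 - e n) *\<^sub>R y + e n *\<^sub>R x + t *\<^sub>R v \<in> S" for n
    by simp
  have "e \<longlonglongrightarrow> 0"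
    unfolding e_def by (rule LIMSEQ_inverse_real_of_nat)
  then have "(\<lambda>n. (1 - e n) *\<^sub>R y + e n *\<^sub>R x + t *\<^sub>R v) \<longlonglongrightarrow> (1 - 0) *\<^sub>R y + 0 *\<^sub>R x + t *\<^sub>R v"
    by (intro tendsto_intros)
  then show "y + t *\<^sub>R v \<in> S"
    using closed_sequentially[OF \<open>closed S\<close> mem] by simp
qed

text \<open>By compactness of the unit sphere, the unit directions from a fixed \<open>x\<close> to
  points of \<open>S\<close> ever farther away accumulate at some \<open>v\<close>, and the ray from
  \<open>x\<close> along \<open>v\<close> is a limit of segments in \<open>S\<close>.\<close>

lemma unbounded_closed_convex_recession:
  fixes S :: "'a::euclidean_space set"
  assumes "closed S" "convex S" "\<not> bounded S"
  obtains v where "v \<noteq> 0" "v \<in> recession_cone S"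
proof -
  obtain x where x: "x \<in> S"
    using assms(3) by force
  have "\<exists>y\<in>S. dist x y > real n" for n
    using assms(3) unfolding bounded_def by (meson not_le)
  then obtain y where y: "\<And>n. y n \<in> S" "\<And>n. dist x (y n) > real n"
    by metis
  define d where "d n = norm (y n - x)" for n
  have d: "d n > real n" for n
    using y(2)[of n] by (simp add: d_def dist_norm norm_minus_commute)
  then have d0: "d n > 0" for n
    by (meson of_nat_0_le_iff le_less_trans)
  define u where "u n = inverse (d n) *\<^sub>R (y n - x)" for n
  have "u n \<in> sphere 0 1" for n
    using d0[of n] by (simp add: u_def d_def)
  then obtain v r where v: "v \<in> sphere (0::'a) 1" and r: "strict_mono r" and lim: "(u \<circ> r) \<longlonglongrightarrow> v"
    using compact_sphere[of "0::'a" 1] unfolding compact_def by meson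
  have "v \<in> recession_cone S"
  proof (rule recession_cone_closed_convexI[OF assms(1,2) x])
    fix t :: real assume t: "t \<ge> 0"
    \<comment> \<open>Since \<open>d n > n\<close>, for \<open>n \<ge> t\<close> this point lies
      between \<open>x\<close> and \<open>y n\<close>.\<close>
    have "x + t *\<^sub>R u n \<in> S" if "t \<le> real n" for n
    proof -
      have "t / d n \<le> 1"
        using that d[of n] d0[of n] by (simp add: field_simps)
      then have "(1 - t / d n) *\<^sub>R x + (t / d n) *\<^sub>R y n \<in> S"
        using t d0[of n] x y(1) by (intro convexD[OF assms(2)]) auto
      then show ?thesis
        by (simp add: u_def algebra_simps divide_inverse)
    qed
    moreover have "\<forall>\<^sub>F n in sequentially. t \<le> real (r n)"
    proof -
      have "\<forall>\<^sub>F n in sequentially. t \<le> real n"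
        using eventually_ge_at_top[of "nat \<lceil>t\<rceil>"] by eventually_elim linarith
      then show ?thesis
        by eventually_elim (meson r seq_suble of_nat_le_iff order_trans)
    qed
    ultimately have "\<forall>\<^sub>F n in sequentially. x + t *\<^sub>R (u \<circ> r) n \<in> S"
      by (auto elim: eventually_mono)
    moreover have "(\<lambda>n. x + t *\<^sub>R (u \<circ> r) n) \<longlonglongrightarrow> x + t *\<^sub>R v"
      by (intro tendsto_intros lim)
    ultimately show "x + t *\<^sub>R v \<in> S"
      by (rule Lim_in_closed_set[OF assms(1) _ sequentially_bot])
  qed
  moreover have "v \<noteq> 0"
    using v by auto
  ultimately show ?thesis
    using that by blast
qed

lemma recession_cone_face_subset:
  fixes S :: "'a::euclidean_space set"
  assumes "closed S" "convex S" "T face_of S" "T \<noteq> {}"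
  shows "recession_cone T \<subseteq> recession_cone S"
proof
  fix v assume v: "v \<in> recession_cone T"
  obtain x where "x \<in> T" using assms(4) by blast
  moreover have "T \<subseteq> S" using assms(3) by (rule face_of_imp_subset)
  ultimately show "v \<in> recession_cone S"
    by (intro recession_cone_closed_convexI[OF assms(1,2), of x])
       (auto dest: recession_coneD[OF v])
qed

text \<open>In a symmetric \<open>S\<close> the whole line through \<open>x \<in> T\<close> along
  \<open>v\<close> stays in \<open>S\<close>. So \<open>x\<close> is the midpoint of a segment in
  \<open>S\<close>, and a face containing that midpoint contains both ends.\<close>

lemma recession_cone_face:
  fixes S :: "'a::euclidean_space set"
  assumes "closed S" "convex S" "T face_of S" "T \<noteq> {}" and sym: "symmetric_recession S"
  shows "recession_cone T = recession_cone S"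
proof
  show "recession_cone S \<subseteq> recession_cone T"
  proof
    fix v assume v: "v \<in> recession_cone S"
    show "v \<in> recession_cone T"
      unfolding recession_cone_def
    proof (intro CollectI ballI allI impI)
      fix x and t :: real
      assume x: "x \<in> T" and "t \<ge> 0"
      show "x + t *\<^sub>R v \<in> T"
      proof (cases "t *\<^sub>R v = 0")
        case False
        define w where "w = t *\<^sub>R v"
        have "w \<noteq> 0" using False by (simp add: w_def)
        have "x - w \<noteq> x + w"
        proof
          assume "x - w = x + w"
          then have "2 *\<^sub>R w = 0" by (simp add: scaleR_2 algebra_simps)
          with \<open>w \<noteq> 0\<close> show False by simp
        qed
        moreover have "x = midpoint (x - w) (x + w)"
          by (simp add: midpoint_def scaleR_2[symmetric])
        ultimately have "x \<in> open_segment (x - w) (x + w)"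
          by (metis midpoint_in_open_segment)
        moreover have "x \<in> S"
          using x face_of_imp_subset[OF assms(3)] by blast
        then have "x + w \<in> S" "x - w \<in> S"
          using symmetric_recessionD[OF sym v, of x t] symmetric_recessionD[OF sym v, of x "- t"]
          by (simp_all add: w_def)
        ultimately show ?thesis
          using face_ofD[OF assms(3)] x unfolding w_def by blast
      qed (use x in auto)
    qed
  qed
qed (rule recession_cone_face_subset[OF assms(1-4)])

text \<open>Used in contrapositive form: every cell having a non-symmetric face is itself
  non-symmetric.\<close>

lemma symmetric_recession_face:
  fixes S :: "'a::euclidean_space set"
  assumes "closed S" "convex S" "T face_of S" "symmetric_recession S"
  shows "symmetric_recession T"
proof (cases "T = {}")
  case True
  then show ?thesis by (simp add: symmetric_recession_def recession_cone_def)
next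
  case False
  then show ?thesis
    using recession_cone_face[OF assms(1-3) False assms(4)] assms(4)
    by (simp add: symmetric_recession_def)
qed

section \<open>Retracting a polyhedron onto its relative frontier\<close>

lemma continuous_on_Max_image:
  fixes f :: "'i \<Rightarrow> 'a::topological_space \<Rightarrow> real"
  assumes "finite I" "I \<noteq> {}" "\<And>i. i \<in> I \<Longrightarrow> continuous_on S (f i)"
  shows "continuous_on S (\<lambda>x. Max ((\<lambda>i. f i x) ` I))"
  using assms
proof (induction rule: finite_ne_induct)
  case (insert i I)
  then show ?case
    by (simp add: continuous_on_max)
qed simp

text \<open>The straight-line homotopy from the identity to \<open>r\<close> stays in
  \<open>S\<close>. Both the removal of a cell and the projection onto sections are retractions of
  this kind.\<close>

lemma homotopy_eqv_segment_retraction: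
  fixes S :: "'a::euclidean_space set"
  assumes "continuous_on S r" "r ` S \<subseteq> T" "T \<subseteq> S" "\<And>x. x \<in> T \<Longrightarrow> r x = x"
    and "\<And>x. x \<in> S \<Longrightarrow> closed_segment x (r x) \<subseteq> S"
  shows "S homotopy_eqv T"
proof (rule deformation_retract_imp_homotopy_eqv)
  show "homotopic_with_canon (\<lambda>x. True) S S id r"
    using assms by (intro homotopic_with_linear) (auto simp: continuous_on_id)
  show "retraction S T r"
    using assms by (auto simp: retraction_def)
qed

text \<open>Each \<open>x\<close> is projected to the relative frontier from a centre \<open>p x\<close> that lies far out on a
  ray in the relative interior. A constraint whose normal is negative on the ray direction \<open>v\<close>
  tells how far out the centre must be for the half-line from \<open>p x\<close> through \<open>x\<close> to leave the
  polyhedron, and \<open>g x\<close> is the Minkowski gauge of \<open>x\<close> with respect to the centre \<open>p x\<close>.\<close>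

lemma polyhedron_retraction_rel_frontier:
  fixes S :: "'a::euclidean_space set"
  assumes "polyhedron S" "\<not> symmetric_recession S"
  obtains r where "continuous_on S r" "r ` S \<subseteq> rel_frontier S"
    "\<And>x. x \<in> rel_frontier S \<Longrightarrow> r x = x"
proof -
  \<comment> \<open>The family of half-spaces is taken minimal, since then the relative interior is
    exactly where all constraints are strict.\<close>
  obtain F where "finite F" and seq: "S = affine hull S \<inter> \<Inter>F"
    and ex: "\<forall>h\<in>F. \<exists>a b. a \<noteq> 0 \<and> h = {x. a \<bullet> x \<le> b}"
    and psub: "\<And>F'. F' \<subset> F \<Longrightarrow> S \<subset> affine hull S \<inter> \<Inter>F'"
    using assms(1) by (simp add: polyhedron_Int_affine_minimal) meson
  obtain a b where ab: "\<And>h. h \<in> F \<Longrightarrow> a h \<noteq> 0 \<and> h = {x. a h \<bullet> x \<le> b h}"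
    using ex by metis
  have relint: "rel_interior S = {x \<in> S. \<forall>h\<in>F. a h \<bullet> x < b h}"
    by (rule rel_interior_polyhedron_explicit[OF \<open>finite F\<close> seq ab psub])
  have memS: "x \<in> S \<longleftrightarrow> x \<in> affine hull S \<and> (\<forall>h\<in>F. a h \<bullet> x \<le> b h)" for x
  proof -
    have "x \<in> \<Inter>F \<longleftrightarrow> (\<forall>h\<in>F. a h \<bullet> x \<le> b h)"
      using ab by blast
    with seq show ?thesis by blast
  qed
  have "closed S" "convex S"
    using assms(1) by (auto simp: polyhedron_imp_closed polyhedron_imp_convex)
  then have "rel_frontier S = S - rel_interior S"
    by (simp add: rel_frontier_def)
  then have relfr: "rel_frontier S = {x \<in> S. \<exists>h\<in>F. a h \<bullet> x = b h}"
    using relint memS by fastforce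
  obtain v where v: "v \<in> recession_cone S" and "- v \<notin> recession_cone S"
    using assms(2) by (auto simp: symmetric_recession_def)
  then obtain y t where y: "y \<in> S" "t \<ge> 0" "y - t *\<^sub>R v \<notin> S"
    by (auto simp: recession_cone_def)
  have aff: "x + c *\<^sub>R v \<in> affine hull S" if "x \<in> affine hull S" for x c
  proof -
    have "y + v \<in> S"
      using recession_coneD[OF v y(1), of 1] by simp
    then have "x + c *\<^sub>R ((y + v) - y) \<in> affine hull S"
      using y(1) that by (intro mem_affine_3_minus) (auto simp: hull_inc)
    then show ?thesis by simp
  qed
  have av: "a h \<bullet> v \<le> 0" if "h \<in> F" for h
  proof (rule ccontr)
    assume "\<not> a h \<bullet> v \<le> 0"
    then have pos: "a h \<bullet> v > 0" by simp
    \<comment> \<open>At this parameter the ray from \<open>y\<close> would reach the value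
      \<open>b h + 1\<close>, beyond the half-space.\<close>
    define s where "s = (b h - a h \<bullet> y + 1) / (a h \<bullet> v)"
    have "a h \<bullet> y \<le> b h"
      using memS y(1) that by blast
    then have "s \<ge> 0"
      using pos by (simp add: s_def)
    then have "a h \<bullet> (y + s *\<^sub>R v) \<le> b h"
      using recession_coneD[OF v y(1)] memS that by blast
    moreover have "s * (a h \<bullet> v) = b h - a h \<bullet> y + 1"
      using pos by (simp add: s_def)
    ultimately show False
      by (simp add: inner_add_right)
  qed
  \<comment> \<open>Going backwards along \<open>v\<close> leaves \<open>S\<close> but not its
    affine hull, so some half-space constraint \<open>k\<close> fails there; its normal must be
    strictly negative on \<open>v\<close>.\<close>
  have "y - t *\<^sub>R v \<in> affine hull S"
    using aff[of y "- t"] y(1) by (simp add: hull_inc)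
  then obtain k where k: "k \<in> F" "a k \<bullet> (y - t *\<^sub>R v) > b k"
    using y(3) memS by force
  have akv: "a k \<bullet> v < 0"
  proof -
    have "a k \<bullet> y \<le> b k"
      using memS y(1) k(1) by blast
    then have "t * (a k \<bullet> v) < 0"
      using k(2) by (simp add: inner_diff_right)
    then show ?thesis
      using y(2) by (simp add: mult_less_0_iff)
  qed
  obtain z where z: "z \<in> rel_interior S"
    using rel_interior_eq_empty[OF \<open>convex S\<close>] y(1) by blast
  \<comment> \<open>This choice gives
    \<open>a k \<bullet> (x - p x) \<ge> - (a k \<bullet> v) > 0\<close>, which makes the gauge
    \<open>g x\<close> positive and the division by it legitimate.\<close>
  define s where "s x = 1 + \<bar>a k \<bullet> z - a k \<bullet> x\<bar> / (- (a k \<bullet> v))" for x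
  define p where "p x = z + s x *\<^sub>R v" for x
  define g where "g x = Max ((\<lambda>h. (a h \<bullet> (x - p x)) / (b h - a h \<bullet> p x)) ` F)" for x
  define r where "r x = p x + inverse (g x) *\<^sub>R (x - p x)" for x
  have s0: "s x > 0" for x
    using akv by (simp add: s_def add_pos_nonneg divide_nonneg_neg)
  have p_lt: "a h \<bullet> p x < b h" if "h \<in> F" for h x
  proof -
    have "a h \<bullet> z < b h"
      using z relint that by blast
    moreover have "s x * (a h \<bullet> v) \<le> 0"
      using s0[of x] av[OF that] by (simp add: mult_nonneg_nonpos)
    ultimately show ?thesis
      by (simp add: p_def inner_add_right)
  qed
  have p_aff: "p x \<in> affine hull S" for x
    unfolding p_def using z rel_interior_subset by (intro aff hull_inc) blast
  have g_ge: "(a h \<bullet> (x - p x)) / (b h - a h \<bullet> p x) \<le> g x" if "h \<in> F" for h x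
    using that \<open>finite F\<close> by (simp add: g_def)
  have g_attained: "\<exists>h\<in>F. g x = (a h \<bullet> (x - p x)) / (b h - a h \<bullet> p x)" for x
  proof -
    have "g x \<in> (\<lambda>h. (a h \<bullet> (x - p x)) / (b h - a h \<bullet> p x)) ` F"
      unfolding g_def using \<open>finite F\<close> k(1) by (intro Max_in) auto
    then show ?thesis by blast
  qed
  have g0: "g x > 0" for x
  proof -
    have "s x * (- (a k \<bullet> v)) = - (a k \<bullet> v) + \<bar>a k \<bullet> z - a k \<bullet> x\<bar>"
      using akv by (simp add: s_def field_simps)
    then have "a k \<bullet> (x - p x) > 0"
      using akv by (simp add: p_def inner_diff_right inner_add_right)
    then have "(a k \<bullet> (x - p x)) / (b k - a k \<bullet> p x) > 0"
      using p_lt[OF k(1)] by simp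
    then show ?thesis
      using g_ge[OF k(1), of x] by linarith
  qed
  \<comment> \<open>The first factor is the positive slack at the centre. As \<open>g x\<close> is
    the largest of the ratios, the product is never positive, and it vanishes for a constraint
    attaining the maximum: \<open>r x\<close> satisfies every constraint, one of them with
    equality.\<close>
  have r_val: "a h \<bullet> r x - b h = (b h - a h \<bullet> p x) * (((a h \<bullet> (x - p x)) / (b h - a h \<bullet> p x)) / g x - 1)"
    if "h \<in> F" for h x
    using p_lt[OF that, of x] g0[of x]
    by (simp add: r_def inner_add_right divide_inverse right_diff_distrib)
  show ?thesis
  proof
    have cs: "continuous_on S s"
      unfolding s_def using akv by (intro continuous_intros) auto
    then have cp: "continuous_on S p"
      unfolding p_def by (intro continuous_intros)
    have "continuous_on S g"
      unfolding g_def
    proof (rule continuous_on_Max_image)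
      fix h assume h: "h \<in> F"
      have "b h - a h \<bullet> p x \<noteq> 0" for x
        using p_lt[OF h, of x] by simp
      then show "continuous_on S (\<lambda>x. a h \<bullet> (x - p x) / (b h - a h \<bullet> p x))"
        by (intro continuous_intros cp) auto
    qed (use \<open>finite F\<close> k(1) in auto)
    moreover have "g x \<noteq> 0" for x
      using g0[of x] by simp
    ultimately show "continuous_on S r"
      unfolding r_def by (intro continuous_intros cp) auto
    show "r ` S \<subseteq> rel_frontier S"
    proof
      fix w assume "w \<in> r ` S"
      then obtain x where x: "x \<in> S" "w = r x" by blast
      have "r x \<in> affine hull S"
        unfolding r_def using x(1) p_aff by (intro mem_affine_3_minus) (auto simp: hull_inc)
      moreover have "a h \<bullet> r x \<le> b h" if "h \<in> F" for h
      proof -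
        have "((a h \<bullet> (x - p x)) / (b h - a h \<bullet> p x)) / g x - 1 \<le> 0"
          using g_ge[OF that, of x] g0[of x] by (simp del: divide_divide_eq_left)
        then have "a h \<bullet> r x - b h \<le> 0"
          unfolding r_val[OF that] using p_lt[OF that, of x] by (simp add: mult_nonneg_nonpos)
        then show ?thesis by simp
      qed
      moreover have "\<exists>h\<in>F. a h \<bullet> r x = b h"
      proof -
        obtain h where h: "h \<in> F" "g x = (a h \<bullet> (x - p x)) / (b h - a h \<bullet> p x)"
          using g_attained by blast
        then have "a h \<bullet> r x - b h = 0"
          unfolding r_val[OF h(1)] h(2)[symmetric] using g0[of x] by simp
        with h(1) show ?thesis by force
      qed
      ultimately show "w \<in> rel_frontier S"
        using memS x(2) by (simp add: relfr)
    qed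
    fix x assume "x \<in> rel_frontier S"
    then obtain h where x: "x \<in> S" and h: "h \<in> F" "a h \<bullet> x = b h"
      by (auto simp: relfr)
    \<comment> \<open>A tight constraint has ratio exactly 1 and no constraint satisfied by
      \<open>x\<close> has a larger one, so the gauge equals 1 on the relative frontier.\<close>
    have "1 \<le> g x"
      using g_ge[OF h(1), of x] p_lt[OF h(1), of x] h(2) by (simp add: inner_diff_right)
    moreover have "g x \<le> 1"
    proof -
      obtain i where i: "i \<in> F" "g x = (a i \<bullet> (x - p x)) / (b i - a i \<bullet> p x)"
        using g_attained by blast
      have "a i \<bullet> x \<le> b i"
        using memS x i(1) by blast
      then show ?thesis
        using p_lt[OF i(1), of x] by (simp add: i(2) inner_diff_right)
    qed
    ultimately show "r x = x"
      by (simp add: r_def)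
  qed
qed

section \<open>Deleting the non-symmetric cells\<close>

lemma polyhedral_complex_closed_convex:
  assumes "polyhedral_complex K" "c \<in> K"
  shows "closed c" "convex c"
  using assms by (auto simp: polyhedral_complex_def polyhedron_imp_closed polyhedron_imp_convex)

text \<open>Only closure under faces is at stake, and \<open>c\<close> is not a face of any
  remaining cell.\<close>

lemma polyhedral_complex_remove_maximal:
  assumes "polyhedral_complex K" and "\<And>d. d \<in> K \<Longrightarrow> c face_of d \<Longrightarrow> d = c"
  shows "polyhedral_complex (K - {c})"
  using assms unfolding polyhedral_complex_def by blast

text \<open>The cell \<open>c\<close> meets the union of the other cells exactly in its relative
  frontier: its facets are other cells, and its intersection with another cell is a proper face. So
  the retraction of \<open>c\<close> can be glued with the identity elsewhere.\<close>

lemma homotopy_eqv_remove_cell: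
  fixes K :: "'a::euclidean_space set set"
  assumes K: "polyhedral_complex K" and c: "c \<in> K" "\<not> symmetric_recession c"
    and max: "\<And>d. d \<in> K \<Longrightarrow> c face_of d \<Longrightarrow> d = c"
  shows "\<Union>K homotopy_eqv \<Union>(K - {c})"
proof -
  have poly: "polyhedron c"
    using K c(1) by (simp add: polyhedral_complex_def)
  obtain r where r: "continuous_on c r" "r ` c \<subseteq> rel_frontier c"
    "\<And>x. x \<in> rel_frontier c \<Longrightarrow> r x = x"
    using polyhedron_retraction_rel_frontier[OF poly c(2)] by blast
  define T where "T = \<Union>(K - {c})"
  have KT: "\<Union>K = c \<union> T"
    using c(1) by (auto simp: T_def)
  have sub: "rel_frontier c \<subseteq> T"
  proof
    fix x assume "x \<in> rel_frontier c"
    then obtain f where f: "f facet_of c" "x \<in> f"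
      using rel_frontier_of_polyhedron[OF poly] by auto
    then have "f \<in> K"
      using K c(1) facet_of_imp_face_of[OF f(1)] unfolding polyhedral_complex_def by blast
    moreover have "f \<noteq> c"
      using f(1) by auto
    ultimately show "x \<in> T"
      using f(2) by (auto simp: T_def)
  qed
  have inter: "x \<in> rel_frontier c" if x: "x \<in> c" "x \<in> T" for x
  proof -
    obtain d where d: "d \<in> K" "d \<noteq> c" "x \<in> d"
      using x by (auto simp: T_def)
    have faces: "(c \<inter> d) face_of c" "(c \<inter> d) face_of d"
      using K c(1) d(1) by (auto simp: polyhedral_complex_def)
    \<comment> \<open>Equality would make \<open>c\<close> a face of the different cell
      \<open>d\<close>.\<close>
    have "c \<inter> d \<noteq> c"
      using max[OF d(1)] faces(2) d(2) by metis
    with faces(1) have "c \<inter> d \<subseteq> rel_frontier c"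
      by (rule face_of_subset_rel_frontier)
    then show ?thesis
      using x d(3) by blast
  qed
  have "closed c" "convex c"
    using polyhedral_complex_closed_convex[OF K c(1)] .
  have "closed T"
    unfolding T_def using K by (intro closed_Union)
      (auto simp: polyhedral_complex_def polyhedron_imp_closed)
  have rc: "r x \<in> c" if "x \<in> c" for x
    using r(2) that rel_frontier_def[of c] closure_closed[OF \<open>closed c\<close>] by auto
  define q where "q x = (if x \<in> c then r x else x)" for x
  have qT: "q x = x" if "x \<in> T" for x
    using inter[OF _ that] r(3) by (auto simp: q_def)
  have "\<Union>K homotopy_eqv T"
  proof (rule homotopy_eqv_segment_retraction)
    have "continuous_on c q"
      using r(1) by (simp add: q_def cong: continuous_on_cong)
    moreover have "continuous_on T q"
      using qT by (simp cong: continuous_on_cong)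
    ultimately show "continuous_on (\<Union>K) q"
      unfolding KT using \<open>closed c\<close> \<open>closed T\<close> by (intro continuous_on_closed_Un)
    show "q ` \<Union>K \<subseteq> T"
      using r(2) sub qT by (auto simp: KT q_def)
    show "T \<subseteq> \<Union>K"
      by (auto simp: KT)
    show "closed_segment x (q x) \<subseteq> \<Union>K" if "x \<in> \<Union>K" for x
    proof (cases "x \<in> c")
      case True
      then have "closed_segment x (q x) \<subseteq> c"
        using rc by (intro closed_segment_subset \<open>convex c\<close>) (auto simp: q_def)
      then show ?thesis
        by (auto simp: KT)
    next
      case False
      then show ?thesis
        using that by (simp add: q_def)
    qed
  qed (rule qT)
  then show ?thesis
    by (simp add: T_def)
qed

lemma polyhedral_complex_symmetric_subcomplex:
  fixes K :: "'a::euclidean_space set set"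
  assumes "polyhedral_complex K"
  shows "\<exists>M\<subseteq>K. polyhedral_complex M \<and> (\<forall>c\<in>M. symmetric_recession c) \<and> \<Union>K homotopy_eqv \<Union>M"
  using assms
proof (induction "card K" arbitrary: K rule: less_induct)
  case less
  have fin: "finite K"
    using less.prems by (simp add: polyhedral_complex_def)
  show ?case
  proof (cases "\<forall>c\<in>K. symmetric_recession c")
    case True
    then show ?thesis
      using less.prems homotopy_equivalent_space_refl by blast
  next
    case False
    define B where "B = {c \<in> K. \<not> symmetric_recession c}"
    have "finite B" "B \<noteq> {}"
      using False fin by (auto simp: B_def)
    then obtain c where c: "c \<in> B" "\<And>d. d \<in> B \<Longrightarrow> c \<subseteq> d \<Longrightarrow> c = d"
      using finite_has_maximal[of B] by blast
    \<comment> \<open>A cell with \<open>c\<close> as a face inherits non-symmetry from it and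
      contains it, so inclusion-maximality among the non-symmetric cells applies.\<close>
    have max: "d = c" if d: "d \<in> K" "c face_of d" for d
    proof -
      have "\<not> symmetric_recession d"
        using symmetric_recession_face[OF polyhedral_complex_closed_convex[OF less.prems d(1)] d(2)]
          c(1) by (auto simp: B_def)
      then show ?thesis
        using c(2)[of d] face_of_imp_subset[OF d(2)] d(1) by (auto simp: B_def)
    qed
    have cK: "c \<in> K" "\<not> symmetric_recession c"
      using c(1) by (auto simp: B_def)
    have "polyhedral_complex (K - {c})"
      using less.prems max by (rule polyhedral_complex_remove_maximal)
    moreover have "card (K - {c}) < card K"
      using fin cK(1) by (rule card_Diff1_less)
    ultimately obtain M where M: "M \<subseteq> K - {c}" "polyhedral_complex M"
        "\<forall>c\<in>M. symmetric_recession c" "\<Union>(K - {c}) homotopy_eqv \<Union>M"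
      using less.hyps by meson
    have "\<Union>K homotopy_eqv \<Union>(K - {c})"
      using less.prems cK max by (rule homotopy_eqv_remove_cell)
    then have "\<Union>K homotopy_eqv \<Union>M"
      using M(4) by (rule homotopy_eqv_trans)
    with M show ?thesis by blast
  qed
qed

section \<open>Sections orthogonal to the recession space\<close>

text \<open>Linearity is recorded because faces are later pulled back along \<open>p\<close> and
  because it yields continuity.\<close>

lemma orthogonal_projection_exists:
  fixes U :: "'a::euclidean_space set"
  assumes "subspace U"
  shows "\<exists>p. linear p \<and> (\<forall>x. p x \<in> U\<^sup>\<bottom> \<and> x - p x \<in> U)"
proof -
  obtain B where B: "B \<subseteq> U" "pairwise orthogonal B" "\<And>x. x \<in> B \<Longrightarrow> norm x = 1"
      "independent B" "card B = dim U" "span B = U"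
    using orthonormal_basis_subspace[OF assms] by metis
  have "finite B"
    using B(4) by (rule independent_imp_finite)
  define p where "p x = x - (\<Sum>b\<in>B. (b \<bullet> x) *\<^sub>R b)" for x
  have "linear p"
    by (rule linearI)
       (simp_all add: p_def inner_add_right scaleR_add_left sum.distrib scaleR_sum_right
         scaleR_diff_right)
  moreover have "x - p x \<in> U" for x
    using B(1) by (auto simp: p_def intro!: subspace_sum[OF assms] subspace_scale[OF assms])
  moreover have "p x \<in> U\<^sup>\<bottom>" for x
  proof -
    have "orthogonal (p x) b" if b: "b \<in> B" for b
    proof -
      have "(\<Sum>d\<in>B. (d \<bullet> x) * (d \<bullet> b)) = (\<Sum>d\<in>B. if d = b then b \<bullet> x else 0)"
        using B(2,3) b by (intro sum.cong)
          (auto simp: pairwise_def orthogonal_def norm_eq_1)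
      then show ?thesis
        using b \<open>finite B\<close>
        by (simp add: p_def orthogonal_def inner_diff_left inner_sum_left inner_commute[of x b])
    qed
    then have "orthogonal (p x) u" if "u \<in> U" for u
      using that B(6) orthogonal_to_span by blast
    then show ?thesis
      by (auto simp: orthogonal_comp_def orthogonal_commute)
  qed
  ultimately show ?thesis by blast
qed

text \<open>A linear map sends an open segment to an open segment or to a single point; in either
  case, if an inner point lands in the face \<open>T\<close>, so do both ends.\<close>

lemma face_of_linear_preimage:
  fixes f :: "'a::euclidean_space \<Rightarrow> 'b::euclidean_space"
  assumes "linear f" "convex S" "f ` S \<subseteq> R" "T face_of R"
  shows "{x \<in> S. f x \<in> T} face_of S"
  unfolding face_of_def
proof (intro conjI ballI impI)
  have "convex T"
    using assms(4) by (rule face_of_imp_convex)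
  then have "convex (f -` T)"
    using assms(1) by (intro convex_linear_vimage)
  then have "convex (S \<inter> f -` T)"
    using assms(2) by (intro convex_Int)
  then show "convex {x \<in> S. f x \<in> T}"
    by (simp add: Int_def)
  fix u v x
  assume u: "u \<in> S" and v: "v \<in> S" and x: "x \<in> {x \<in> S. f x \<in> T}" and seg: "x \<in> open_segment u v"
  have "f u \<in> T \<and> f v \<in> T"
  proof (cases "f u = f v")
    case True
    obtain t where "x = (1 - t) *\<^sub>R u + t *\<^sub>R v"
      using seg by (auto simp: in_segment)
    then have "f x = f u"
      using True assms(1) by (simp add: linear_add linear_scale flip: scaleR_add_left)
    then show ?thesis using True x by simp
  next
    case False
    obtain t where "0 < t" "t < 1" "x = (1 - t) *\<^sub>R u + t *\<^sub>R v"
      using seg by (auto simp: in_segment)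
    then have "f x \<in> open_segment (f u) (f v)"
      using False assms(1) by (auto simp: in_segment linear_add linear_scale)
    then show ?thesis
      using face_ofD[OF assms(4)] u v x assms(3) by blast
  qed
  then show "u \<in> {x \<in> S. f x \<in> T}" "v \<in> {x \<in> S. f x \<in> T}"
    using u v by auto
qed simp

text \<open>For a nonempty symmetric cell the recession cone is the lineality space, and the cell is
  the orthogonal sum of this section and that space.\<close>

definition lineality_section :: "'a::euclidean_space set \<Rightarrow> 'a set" where
  "lineality_section S = S \<inter> (recession_cone S)\<^sup>\<bottom>"

text \<open>An unbounded section would contain a ray. Its direction is a recession direction of
  \<open>S\<close> and, as a difference of two points of the section, is orthogonal to all of these,
  hence to itself.\<close>

lemma bounded_lineality_section:
  fixes S :: "'a::euclidean_space set"
  assumes "closed S" "convex S"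
  shows "bounded (lineality_section S)"
proof (rule ccontr)
  let ?T = "lineality_section S"
  assume "\<not> bounded ?T"
  moreover have "closed ?T" "convex ?T"
    using assms by (auto simp: lineality_section_def closed_subspace subspace_orthogonal_comp
        subspace_imp_convex intro!: closed_Int convex_Int)
  ultimately obtain v where v: "v \<noteq> 0" "v \<in> recession_cone ?T"
    using unbounded_closed_convex_recession by blast
  obtain x where x: "x \<in> ?T"
    using \<open>\<not> bounded ?T\<close> by force
  have T: "x + t *\<^sub>R v \<in> ?T" if "t \<ge> 0" for t
    using v(2) x that by (rule recession_coneD)
  have "v \<in> recession_cone S"
    using T x by (intro recession_cone_closed_convexI[OF assms]) (auto simp: lineality_section_def)
  moreover have "(x + 1 *\<^sub>R v) - x \<in> (recession_cone S)\<^sup>\<bottom>"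
    using T[of 1] x by (intro subspace_diff[OF subspace_orthogonal_comp]) (auto simp: lineality_section_def)
  ultimately have "orthogonal v v"
    by (simp add: orthogonal_comp_def)
  with v(1) show False by (simp add: orthogonal_def)
qed

text \<open>Cells that meet share a nonempty face and therefore their recession cone. Hence taking
  sections commutes with intersections and faces, and the projections of the single cells agree
  wherever cells overlap.\<close>

lemma bounded_complex_of_symmetric:
  fixes M :: "'a::euclidean_space set set"
  assumes M: "polyhedral_complex M" and sym: "\<And>c. c \<in> M \<Longrightarrow> symmetric_recession c"
  shows "polyhedral_complex (lineality_section ` M)"
    and "\<Union>M homotopy_eqv \<Union>(lineality_section ` M)"
proof -
  let ?s = "lineality_section :: 'a set \<Rightarrow> 'a set"
  have fin: "finite M"
    using M by (simp add: polyhedral_complex_def)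
  note cc = polyhedral_complex_closed_convex[OF M]
  have rec_face: "recession_cone f = recession_cone c" if "c \<in> M" "f face_of c" "f \<noteq> {}" for c f
    using recession_cone_face[OF cc that(2,3) sym] that(1) by blast
  have int_face: "(c \<inter> d) face_of c" "(c \<inter> d) face_of d" if "c \<in> M" "d \<in> M" for c d
    using M that by (auto simp: polyhedral_complex_def)
  have rec_eq: "recession_cone c = recession_cone d" if "c \<in> M" "d \<in> M" "c \<inter> d \<noteq> {}" for c d
    using rec_face int_face that by metis
  \<comment> \<open>The projection is chosen per subspace and not per cell, so that cells with equal
    recession cones receive the same map.\<close>
  have "\<forall>U::'a set. \<exists>p. subspace U \<longrightarrow> linear p \<and> (\<forall>x. p x \<in> U\<^sup>\<bottom> \<and> x - p x \<in> U)"
    using orthogonal_projection_exists by blast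
  then obtain P where P: "\<And>U::'a set. subspace U \<Longrightarrow> linear (P U)"
      "\<And>(U::'a set) x. subspace U \<Longrightarrow> P U x \<in> U\<^sup>\<bottom>" "\<And>(U::'a set) x. subspace U \<Longrightarrow> x - P U x \<in> U"
    by metis
  define p where "p c = P (recession_cone c)" for c
  have sub: "subspace (recession_cone c)" if "c \<in> M" for c
    using sym[OF that] by (rule subspace_recession_cone)
  have p_lin: "linear (p c)" if "c \<in> M" for c
    using P(1)[OF sub[OF that]] by (simp add: p_def)
  have p_sec: "p c x \<in> ?s c" if "c \<in> M" "x \<in> c" for c x
  proof -
    have "x - p c x \<in> recession_cone c"
      using P(3)[OF sub[OF that(1)]] by (simp add: p_def)
    then have "x + (- 1) *\<^sub>R (x - p c x) \<in> c"
      by (rule symmetric_recessionD[OF sym[OF that(1)] _ that(2)])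
    then show ?thesis
      using P(2)[OF sub[OF that(1)]] by (simp add: lineality_section_def p_def)
  qed
  have p_id: "p c x = x" if "c \<in> M" "x \<in> ?s c" for c x
  proof -
    let ?U = "recession_cone c"
    have "x - p c x \<in> ?U" "x - p c x \<in> ?U\<^sup>\<bottom>"
      using P(2,3)[OF sub[OF that(1)], of x] that(2)
      by (auto simp: p_def lineality_section_def intro: subspace_diff[OF subspace_orthogonal_comp])
    then have "orthogonal (x - p c x) (x - p c x)"
      by (simp add: orthogonal_comp_def)
    then show ?thesis by (simp add: orthogonal_def)
  qed
  have sec_face: "?s f face_of ?s c" if "c \<in> M" "f face_of c" for c f
  proof (cases "f = {}")
    case False
    then show ?thesis
      using rec_face[OF that False] that(2)
      by (simp add: lineality_section_def face_of_slice subspace_imp_convex subspace_orthogonal_comp)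
  qed (simp add: lineality_section_def)
  have sec_int: "?s c \<inter> ?s d = ?s (c \<inter> d)" if "c \<in> M" "d \<in> M" for c d
  proof (cases "c \<inter> d = {}")
    case False
    then show ?thesis
      using rec_eq[OF that False] rec_face[OF that(1) int_face(1)[OF that] False]
      by (auto simp: lineality_section_def)
  qed (auto simp: lineality_section_def)
  show "polyhedral_complex (?s ` M)"
    unfolding polyhedral_complex_def
  proof (intro conjI ballI allI impI)
    show "finite (?s ` M)"
      using fin by simp
    show "polyhedron C" if "C \<in> ?s ` M" for C
    proof -
      obtain c where "c \<in> M" "C = c \<inter> (recession_cone c)\<^sup>\<bottom>"
        using \<open>C \<in> ?s ` M\<close> by (auto simp: lineality_section_def)
      moreover have "polyhedron ((recession_cone c)\<^sup>\<bottom>)"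
        by (intro affine_imp_polyhedron subspace_imp_affine subspace_orthogonal_comp)
      ultimately show ?thesis
        using M by (simp add: polyhedral_complex_def)
    qed
  next
    fix C f assume "C \<in> ?s ` M" and f: "f face_of C"
    then obtain c where c: "c \<in> M" "C = ?s c" by blast
    \<comment> \<open>A face \<open>f\<close> of the section is lifted to the face of
      \<open>c\<close> lying over it under the projection. Its section is \<open>f\<close> again,
      because the projection fixes the section pointwise.\<close>
    define g where "g = {x \<in> c. p c x \<in> f}"
    have g: "g face_of c"
      unfolding g_def using p_lin[OF c(1)] cc(2)[OF c(1)] p_sec[OF c(1)] f c(2)
      by (intro face_of_linear_preimage[where R = C]) auto
    then have "g \<in> M"
      using M c(1) by (auto simp: polyhedral_complex_def)
    moreover have "f = ?s g"
    proof -
      have fs: "f \<subseteq> ?s c" "?s c \<subseteq> c"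
        using face_of_imp_subset[OF f] by (auto simp: c(2) lineality_section_def)
      have "x \<in> g \<longleftrightarrow> x \<in> f" if "x \<in> ?s c" for x
        using p_id[OF c(1) that] that fs(2) by (auto simp: g_def)
      with fs(1) have "f = g \<inter> ?s c" by blast
      also have "\<dots> = ?s g"
      proof (cases "g = {}")
        case False
        then show ?thesis
          using rec_face[OF c(1) g] face_of_imp_subset[OF g] by (auto simp: lineality_section_def)
      qed (simp add: lineality_section_def)
      finally show ?thesis .
    qed
    ultimately show "f \<in> ?s ` M" by blast
  next
    fix C D assume "C \<in> ?s ` M" "D \<in> ?s ` M"
    then obtain c d where cd: "c \<in> M" "d \<in> M" "C = ?s c" "D = ?s d" by blast
    show "C \<inter> D face_of C" "C \<inter> D face_of D"
      using sec_face[OF cd(1) int_face(1)[OF cd(1,2)]] sec_face[OF cd(2) int_face(2)[OF cd(1,2)]]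
      by (simp_all add: cd(3,4) sec_int[OF cd(1,2)])
  qed
  \<comment> \<open>The choice of the cell does not matter: all cells containing \<open>x\<close>
    have the same recession cone. This makes \<open>q\<close> agree with \<open>p c\<close> on each
    cell \<open>c\<close>, so continuity can be checked on the finitely many closed cells.\<close>
  define q where "q x = p (SOME c. c \<in> M \<and> x \<in> c) x" for x
  have q: "q x = p c x" if "c \<in> M" "x \<in> c" for c x
  proof -
    define d where "d = (SOME c. c \<in> M \<and> x \<in> c)"
    have d: "d \<in> M \<and> x \<in> d"
      unfolding d_def by (rule someI[of _ c]) (use that in simp)
    then have "recession_cone d = recession_cone c"
      using that by (intro rec_eq) auto
    then show ?thesis
      by (simp add: q_def p_def flip: d_def)
  qed
  show "\<Union>M homotopy_eqv \<Union>(?s ` M)"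
  proof (rule homotopy_eqv_segment_retraction)
    have "continuous_on c q" if "c \<in> M" for c
      using q[OF that] linear_continuous_on_compose[OF continuous_on_id p_lin[OF that]]
      by (simp cong: continuous_on_cong)
    then have "continuous_on (\<Union>c\<in>M. c) q"
      using fin cc(1) by (intro continuous_on_closed_Union)
    then show "continuous_on (\<Union>M) q" by simp
    show "q ` \<Union>M \<subseteq> \<Union>(?s ` M)"
      using q p_sec by fastforce
    show "\<Union>(?s ` M) \<subseteq> \<Union>M"
      by (auto simp: lineality_section_def)
    show "q x = x" if "x \<in> \<Union>(?s ` M)" for x
    proof -
      obtain c where c: "c \<in> M" "x \<in> ?s c" using \<open>x \<in> \<Union>(?s ` M)\<close> by blast
      then show ?thesis
        using q[OF c(1), of x] p_id by (simp add: lineality_section_def)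
    qed
    show "closed_segment x (q x) \<subseteq> \<Union>M" if "x \<in> \<Union>M" for x
    proof -
      obtain c where c: "c \<in> M" "x \<in> c" using \<open>x \<in> \<Union>M\<close> by blast
      then have "closed_segment x (q x) \<subseteq> c"
        using q[OF c] p_sec[OF c] by (intro closed_segment_subset cc) (auto simp: lineality_section_def)
      then show ?thesis using c(1) by blast
    qed
  qed
qed

section \<open>The bounded complex and its number of cells\<close>

theorem theorem4p1:
  fixes K :: "(real ^ 'n) set set"
  assumes "polyhedral_complex K"
  shows "\<exists>L :: (real ^ 'n) set set.
           polyhedral_complex L \<and> (\<forall>c\<in>L. bounded c) \<and> card L \<le> card K \<and>
           (\<Union>K) homotopy_eqv (\<Union>L)"
proof -
  have "finite K"
    using assms by (simp add: polyhedral_complex_def)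
  obtain M where M: "M \<subseteq> K" "polyhedral_complex M" "\<And>c. c \<in> M \<Longrightarrow> symmetric_recession c"
      "\<Union>K homotopy_eqv \<Union>M"
    using polyhedral_complex_symmetric_subcomplex[OF assms] by blast
  let ?L = "lineality_section ` M"
  have "finite M"
    using M(1) \<open>finite K\<close> by (rule finite_subset)
  then have "card ?L \<le> card M"
    by (rule card_image_le)
  also have "\<dots> \<le> card K"
    using \<open>finite K\<close> M(1) by (rule card_mono)
  finally have "card ?L \<le> card K" .
  moreover have "\<forall>c\<in>?L. bounded c"
    using bounded_lineality_section polyhedral_complex_closed_convex[OF M(2)] by blast
  moreover have "\<Union>K homotopy_eqv \<Union>?L"
    using M(4) bounded_complex_of_symmetric(2)[OF M(2,3)] by (rule homotopy_eqv_trans)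
  ultimately show ?thesis
    using bounded_complex_of_symmetric(1)[OF M(2,3)] by blast
qed

end
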